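(* Let $\mathcal{R}_{\text{BL}} \cup \mathcal{R}_{\text{TL}}$ be the range family of all bottomless and topless rectangles in $\mathbb{R}^2$. Then for every positive integer $k$, $$m_{\mathcal{R}_{\text{BL}}\cup\mathcal{R}_{\text{TL}}}(k) \;\leq\; 2\, m_{\mathcal{R}_{\text{BL}}}(k) + 1 \;\leq\; 6k-3 .$$
   Context: The family of all bottomless rectangles is $\mathcal{R}_{\text{BL}} = \{ [a,b] \times (-\infty,c] \mid a,b,c \in \mathbb{R} \}$ and the family of all topless rectangles is $\mathcal{R}_{\text{TL}} = \{ [a,b] \times [c,\infty) \mid a,b,c \in \mathbb{R} \}$. For a range family $\mathcal{R}$ (a family of subsets of $\mathbb{R}^2$), a finite point set $V \subset \mathbb{R}^2$ and a positive integer $m$, $\mathcal{H}(V,\mathcal{R},m)$ is the hypergraph with vertex set $V$ whose hyperedges are exactly the subsets $e \subseteq V$ with $|e| = m$ for which there is some $R \in \mathcal{R}$ with $e = V \cap R$. A polychromatic $k$-coloring of a hypergraph is a map from its vertices to $\{1,\ldots,k\}$ such that every hyperedge contains vertices of all $k$ colors. The quantity $m_{\mathcal{R}}(k)$ is the smallest positive integer $m$ (or $\infty$ if none exists) such that for every finite $V \subset \mathbb{R}^2$ in general position (distinct points of $V$ have different $x$-coordinates and different $y$-coordinates) the hypergraph $\mathcal{H}(V,\mathcal{R},m)$ has a polychromatic $k$-coloring. *)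

theory Defs
  imports Complex_Main "HOL-Library.Extended_Nat" "HOL-Library.FuncSet"
begin

type_synonym point = "real \<times> real"

definition bottomless_rectangles :: "point set set" where
  "bottomless_rectangles = {{a..b} \<times> {..c} | a b c. True}"

definition topless_rectangles :: "point set set" where
  "topless_rectangles = {{a..b} \<times> {c..} | a b c. True}"

definition general_position :: "point set \<Rightarrow> bool" where
  "general_position V \<longleftrightarrow>
     (\<forall>p\<in>V. \<forall>q\<in>V. p \<noteq> q \<longrightarrow> fst p \<noteq> fst q \<and> snd p \<noteq> snd q)"

text \<open>A hypergraph is the pair of its vertex set and its set of hyperedges.\<close>

type_synonym 'a hypergraph = "'a set \<times> 'a set set"

definition range_hypergraph :: "point set \<Rightarrow> point set set \<Rightarrow> nat \<Rightarrow> point hypergraph" where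
  "range_hypergraph V \<R> m = (V, {e. e \<subseteq> V \<and> card e = m \<and> (\<exists>R\<in>\<R>. e = V \<inter> R)})"

definition polychromatic_coloring :: "'a hypergraph \<Rightarrow> nat \<Rightarrow> ('a \<Rightarrow> nat) \<Rightarrow> bool" where
  "polychromatic_coloring H k c \<longleftrightarrow>
     c \<in> fst H \<rightarrow> {1..k} \<and> (\<forall>e\<in>snd H. \<forall>i\<in>{1..k}. \<exists>v\<in>e. c v = i)"

text \<open>The infimum of the empty set in \<^typ>\<open>enat\<close> is \<open>\<infinity>\<close>; a nonempty set has a least element.\<close>

definition m_poly :: "point set set \<Rightarrow> nat \<Rightarrow> enat" where
  "m_poly \<R> k = Inf {enat m | m. m \<ge> 1 \<and>
     (\<forall>V. finite V \<and> general_position V \<longrightarrow>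
        (\<exists>c. polychromatic_coloring (range_hypergraph V \<R> m) k c))}"

end

theory Submission
  imports Defs
begin

text \<open>
  For the second inequality one shows \<open>m \<le> 3k - 2\<close> for bottomless rectangles by sweeping a
  horizontal line upwards. A point joins the set when the line reaches it, and a bottomless rectangle
  of height \<open>t\<close> cuts out a block of points that are consecutive in \<open>x\<close>-order at time \<open>t\<close>. So the
  points have to be coloured while they are inserted, in such a way that at every time every block of
  \<open>3k - 2\<close> consecutive points shows all colours. Points enter uncoloured, and a point is coloured only
  when some block forces it. The invariant is that two points of the same colour are at least \<open>k\<close>
  places apart in \<open>x\<close>-order; insertions preserve it, because they only increase distances.
  Suppose a block of \<open>3k - 2\<close> points lacks colour \<open>i\<close>. Its middle \<open>k\<close> points are pairwise less than
  \<open>k\<close> places apart, so those of them that are coloured have different colours, all different from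
  \<open>i\<close>; hence there are at most \<open>k - 1\<close> of these and one middle point is uncoloured. It has at least \<open>k - 1\<close>
  points of the block on either side, so it can receive colour \<open>i\<close> without violating the invariant
  (lemma \<open>spaced_recolor\<close>).

  For the first inequality, group the points into pairs that are neighbours in \<open>x\<close>-order, and let
  \<open>A\<close> contain the lower point of each pair. A bottomless rectangle that contains the upper point of
  a pair also contains the lower one, unless the pair is cut by a vertical side of the rectangle. At
  most two pairs are cut, so among \<open>2m + 1\<close> points at least \<open>m\<close> belong to \<open>A\<close>. By symmetry a topless
  rectangle with \<open>2m + 1\<close> points has at least \<open>m\<close> points outside \<open>A\<close> (lemma \<open>ex_balanced_partition\<close>).
  It therefore suffices to colour \<open>A\<close> for bottomless and its complement for topless rectangles,
  both with the threshold \<open>m\<close>: rectangles of either kind can be shrunk until they contain exactly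
  \<open>m\<close> points.
\<close>

section \<open>Ranks\<close>

definition rank :: "('a \<Rightarrow> 'b::linorder) \<Rightarrow> 'a set \<Rightarrow> 'a \<Rightarrow> nat" where
  "rank f V v = card {u \<in> V. f u < f v}"

lemma rank_less_iff:
  assumes "finite V" "u \<in> V" "v \<in> V"
  shows "rank f V u < rank f V v \<longleftrightarrow> f u < f v"
proof
  assume "f u < f v"
  then have "{w \<in> V. f w < f u} \<subset> {w \<in> V. f w < f v}"
    using assms by force
  then show "rank f V u < rank f V v"
    using assms by (simp add: rank_def psubset_card_mono)
next
  assume *: "rank f V u < rank f V v"
  show "f u < f v"
  proof (rule ccontr)
    assume "\<not> f u < f v"
    then have "{w \<in> V. f w < f v} \<subseteq> {w \<in> V. f w < f u}"
      by auto
    then have "rank f V v \<le> rank f V u"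
      using assms by (simp add: rank_def card_mono)
    with * show False by simp
  qed
qed

lemma rank_le_iff:
  assumes "finite V" "u \<in> V" "v \<in> V"
  shows "rank f V u \<le> rank f V v \<longleftrightarrow> f u \<le> f v"
  using rank_less_iff[OF assms(1,3,2), of f]
  unfolding linorder_not_less[symmetric] by simp

lemma bij_betw_rank:
  assumes "finite V" "inj_on f V"
  shows "bij_betw (rank f V) V {..<card V}"
proof -
  have inj: "inj_on (rank f V) V"
  proof (rule inj_onI)
    fix u v assume "u \<in> V" "v \<in> V" "rank f V u = rank f V v"
    then have "f u = f v"
      using rank_le_iff[OF assms(1), of u v f] rank_le_iff[OF assms(1), of v u f] by simp
    with \<open>u \<in> V\<close> \<open>v \<in> V\<close> show "u = v"
      using assms(2) by (simp add: inj_on_eq_iff)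
  qed
  have "rank f V ` V \<subseteq> {..<card V}"
  proof
    fix n assume "n \<in> rank f V ` V"
    then obtain v where "v \<in> V" "n = rank f V v" by blast
    moreover have "{u \<in> V. f u < f v} \<subset> V"
      using \<open>v \<in> V\<close> by auto
    ultimately show "n \<in> {..<card V}"
      using assms(1) by (simp add: rank_def psubset_card_mono)
  qed
  moreover have "card (rank f V ` V) = card {..<card V}"
    using inj by (simp add: card_image)
  ultimately have "rank f V ` V = {..<card V}"
    by (intro card_subset_eq) auto
  with inj show ?thesis by (simp add: bij_betw_def)
qed

lemma ex_of_rank:
  assumes "finite V" "inj_on f V" "n < card V"
  obtains v where "v \<in> V" "rank f V v = n"
proof -
  have "n \<in> rank f V ` V"
    using bij_betw_rank[OF assms(1,2)] assms(3) by (simp add: bij_betw_def)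
  then show ?thesis using that by blast
qed

lemma card_rank_mem:
  assumes "finite V" "inj_on f V" "N \<subseteq> {..<card V}"
  shows "card {v \<in> V. rank f V v \<in> N} = card N"
proof -
  have "bij_betw (rank f V) {v \<in> V. rank f V v \<in> N} N"
    using bij_betw_rank[OF assms(1,2)] assms(3)
    unfolding bij_betw_def by (auto simp: inj_on_def)
  then show ?thesis by (rule bij_betw_same_card)
qed

lemma ex_lower_part_card:
  fixes f :: "'a \<Rightarrow> 'b::linorder"
  assumes "finite V" "inj_on f V" "1 \<le> m" "m \<le> card V"
  obtains t where "card {v \<in> V. f v \<le> t} = m"
proof -
  have "m - 1 < card V" using assms(3,4) by simp
  then obtain w where w: "w \<in> V" "rank f V w = m - 1"
    using ex_of_rank[OF assms(1,2)] by blast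
  have "{v \<in> V. f v \<le> f w} = {v \<in> V. rank f V v \<in> {..<m}}"
    using rank_le_iff[OF assms(1) _ w(1), of _ f] w(2) assms(3) by force
  then have "card {v \<in> V. f v \<le> f w} = m"
    using card_rank_mem[OF assms(1,2), of "{..<m}"] assms(4) by simp
  then show ?thesis by (rule that)
qed

section \<open>Polychromatic thresholds\<close>

definition threshold :: "point set set \<Rightarrow> nat \<Rightarrow> nat \<Rightarrow> bool" where
  "threshold \<R> k m \<longleftrightarrow> m \<ge> 1 \<and>
     (\<forall>V. finite V \<and> general_position V \<longrightarrow>
        (\<exists>c. c \<in> V \<rightarrow> {1..k} \<and> (\<forall>R\<in>\<R>. card (V \<inter> R) = m \<longrightarrow> {1..k} \<subseteq> c ` (V \<inter> R))))"

lemma m_poly_eq_Inf_threshold: "m_poly \<R> k = Inf {enat m | m. threshold \<R> k m}"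
proof -
  have "polychromatic_coloring (range_hypergraph V \<R> m) k c \<longleftrightarrow>
      c \<in> V \<rightarrow> {1..k} \<and> (\<forall>R\<in>\<R>. card (V \<inter> R) = m \<longrightarrow> {1..k} \<subseteq> c ` (V \<inter> R))" for V m c
  proof -
    have "(\<forall>e\<in>snd (range_hypergraph V \<R> m). Q e) \<longleftrightarrow> (\<forall>R\<in>\<R>. card (V \<inter> R) = m \<longrightarrow> Q (V \<inter> R))" for Q
      unfolding range_hypergraph_def by auto
    moreover have "(\<forall>i\<in>{1..k}. \<exists>v\<in>e. c v = i) \<longleftrightarrow> {1..k} \<subseteq> c ` e" for e
      unfolding subset_iff image_iff Ball_def Bex_def by metis
    ultimately show ?thesis
      unfolding polychromatic_coloring_def by (simp add: range_hypergraph_def)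
  qed
  then show ?thesis
    unfolding m_poly_def threshold_def by presburger
qed

lemma m_poly_le: "threshold \<R> k m \<Longrightarrow> m_poly \<R> k \<le> enat m"
  unfolding m_poly_eq_Inf_threshold by (rule Inf_lower) blast

text \<open>
  The bound \<open>2m + 1\<close> is derived from colourings, so the infimum has to be an actual threshold; this
  holds as soon as some threshold exists.
\<close>

lemma m_poly_attained:
  assumes "threshold \<R> k m"
  obtains n where "m_poly \<R> k = enat n" "threshold \<R> k n"
proof -
  let ?S = "{enat m | m. threshold \<R> k m}"
  have "enat m \<in> ?S" using assms by blast
  then have "Inf ?S \<in> ?S"
    unfolding Inf_enat_def by (auto intro: LeastI)
  then show ?thesis
    using that unfolding m_poly_eq_Inf_threshold by blast
qed

lemma inj_on_fst_general_position: "general_position V \<Longrightarrow> inj_on fst V"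
  unfolding general_position_def inj_on_def by blast

lemma inj_on_snd_general_position: "general_position V \<Longrightarrow> inj_on snd V"
  unfolding general_position_def inj_on_def by blast

lemma general_position_subset: "general_position V \<Longrightarrow> W \<subseteq> V \<Longrightarrow> general_position W"
  unfolding general_position_def by blast

section \<open>Bottomless rectangles\<close>

text \<open>
  Colour \<open>0\<close> marks points that are still uncoloured. The half-open count is the difference of the
  positions of \<open>p\<close> and \<open>q\<close> in \<open>x\<close>-order.
\<close>

definition spaced :: "point set \<Rightarrow> nat \<Rightarrow> (point \<Rightarrow> nat) \<Rightarrow> bool" where
  "spaced V k c \<longleftrightarrow> (\<forall>p\<in>V. \<forall>q\<in>V. fst p < fst q \<and> c p = c q \<and> c p \<noteq> 0 \<longrightarrow>
      k \<le> card {v \<in> V. fst p < fst v \<and> fst v \<le> fst q})"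

text \<open>
  The hypothesis excludes colour \<open>i\<close> from the block \<open>a..b\<close>, so the pigeonhole principle on the middle
  \<open>k\<close> points has only \<open>k - 1\<close> colours available. The number \<open>3k - 2 = (k - 1) + k + (k - 1)\<close> leaves
  \<open>k - 1\<close> points of the block on each side of the middle, which keep the recoloured point away from
  all points of colour \<open>i\<close>, since those lie outside the block.
\<close>

lemma spaced_recolor:
  assumes fin: "finite V" and inj: "inj_on fst V"
    and le: "\<forall>v\<in>V. c v \<le> k" and spaced: "spaced V k c"
    and i: "i \<in> {1..k}"
    and card_S: "card {v \<in> V. a \<le> fst v \<and> fst v \<le> b} = 3 * k - 2"
    and no_i: "\<forall>v\<in>V. a \<le> fst v \<and> fst v \<le> b \<longrightarrow> c v \<noteq> i"
  obtains u where "u \<in> V" "c u = 0" "spaced V k (c(u := i))"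
proof -
  define S where "S = {v \<in> V. a \<le> fst v \<and> fst v \<le> b}"
  have finS: "finite S" and injS: "inj_on fst S" and SV: "S \<subseteq> V" and cardS: "card S = 3 * k - 2"
    using fin inj card_S by (auto simp: S_def intro: inj_on_subset)
  define r where "r = rank fst S"
  have r_le: "r u \<le> r v \<longleftrightarrow> fst u \<le> fst v" and r_less: "r u < r v \<longleftrightarrow> fst u < fst v"
    if "u \<in> S" "v \<in> S" for u v
    using that finS by (simp_all add: r_def rank_le_iff rank_less_iff)
  have card_r: "card {v \<in> S. r v \<in> N} = card N" if "N \<subseteq> {..<3 * k - 2}" for N
    using card_rank_mem[OF finS injS] that cardS by (simp add: r_def)
  \<comment> \<open>the middle \<open>k\<close> points of the block\<close>
  define M where "M = {v \<in> S. r v \<in> {k-1..<2*k-1}}"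
  have cardM: "card M = k"
    using i by (subst M_def, subst card_r) auto
  have finM: "finite M" using finS by (simp add: M_def)
  have "\<exists>u\<in>M. c u = 0"
  proof (rule ccontr)
    assume nz: "\<not> (\<exists>u\<in>M. c u = 0)"
    have "c ` M \<subseteq> {1..k} - {i}"
      using nz le no_i unfolding M_def S_def by force
    then have "card (c ` M) \<le> card ({1..k} - {i})"
      by (intro card_mono) auto
    also have "\<dots> < card M"
      using i cardM by simp
    finally have "\<not> inj_on c M"
      by (rule pigeonhole)
    then obtain p q where pq: "p \<in> M" "q \<in> M" "p \<noteq> q" "c p = c q"
      unfolding inj_on_def by blast
    have "\<exists>p\<in>M. \<exists>q\<in>M. fst p < fst q \<and> c p = c q"
    proof (cases "fst p < fst q")
      case False
      then have "fst q < fst p"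
        using pq injS unfolding M_def inj_on_def by force
      with pq show ?thesis by metis
    qed (use pq in blast)
    then obtain p q where pq: "p \<in> M" "q \<in> M" "fst p < fst q" "c p = c q"
      by blast
    have "{v \<in> V. fst p < fst v \<and> fst v \<le> fst q} \<subseteq> M - {p}"
    proof
      fix v assume v: "v \<in> {v \<in> V. fst p < fst v \<and> fst v \<le> fst q}"
      have "v \<in> S" using v pq unfolding M_def S_def by auto
      moreover have "p \<in> S" "q \<in> S" using pq by (auto simp: M_def)
      ultimately have "r p < r v" "r v \<le> r q"
        using v by (auto simp: r_le r_less)
      with \<open>v \<in> S\<close> v pq show "v \<in> M - {p}"
        by (auto simp: M_def)
    qed
    then have "card {v \<in> V. fst p < fst v \<and> fst v \<le> fst q} \<le> card (M - {p})"
      using finM by (intro card_mono) auto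
    also have "\<dots> < k" using pq cardM i finM by simp
    also have "k \<le> card {v \<in> V. fst p < fst v \<and> fst v \<le> fst q}"
      using spaced pq nz SV unfolding spaced_def M_def by blast
    finally show False by simp
  qed
  then obtain u where u: "u \<in> M" "c u = 0" by blast
  have uS: "u \<in> S" and uV: "u \<in> V" and ru: "k - 1 \<le> r u" "r u < 2 * k - 1"
    using u SV by (auto simp: M_def)
  have left: "k \<le> card {v \<in> V. fst q < fst v \<and> fst v \<le> fst u}"
    if "q \<in> V" "c q = i" "fst q < fst u" for q
  proof -
    have "fst q < a"
      using that no_i uS by (force simp: S_def)
    have "k \<le> card {..r u}" using ru by simp
    also have "\<dots> = card {v \<in> S. r v \<in> {..r u}}"
      using ru by (subst card_r) auto
    also have "\<dots> \<le> card {v \<in> V. fst q < fst v \<and> fst v \<le> fst u}"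
      using \<open>fst q < a\<close> uS fin by (intro card_mono) (auto simp: r_le, auto simp: S_def)
    finally show ?thesis .
  qed
  \<comment> \<open>To the right of \<open>u\<close> only \<open>k - 1\<close> points of the block are certain; \<open>q\<close> itself is the \<open>k\<close>-th.\<close>
  have right: "k \<le> card {v \<in> V. fst u < fst v \<and> fst v \<le> fst q}"
    if "q \<in> V" "c q = i" "fst u < fst q" for q
  proof -
    have q: "b < fst q" "q \<notin> S"
      using that no_i uS by (force simp: S_def)+
    have "k \<le> Suc (card {Suc (r u)..<3*k-2})" using ru by simp
    also have "\<dots> = Suc (card {v \<in> S. r v \<in> {Suc (r u)..<3*k-2}})"
      by (subst card_r) auto
    also have "\<dots> = card (insert q {v \<in> S. r v \<in> {Suc (r u)..<3*k-2}})"
      using q finS by simp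
    also have "\<dots> \<le> card {v \<in> V. fst u < fst v \<and> fst v \<le> fst q}"
    proof (rule card_mono)
      show "insert q {v \<in> S. r v \<in> {Suc (r u)..<3*k-2}} \<subseteq> {v \<in> V. fst u < fst v \<and> fst v \<le> fst q}"
      proof
        fix v assume "v \<in> insert q {v \<in> S. r v \<in> {Suc (r u)..<3*k-2}}"
        then consider "v = q" | "v \<in> S" "r u < r v" by auto
        then show "v \<in> {v \<in> V. fst u < fst v \<and> fst v \<le> fst q}"
        proof cases
          case 2
          then have "fst u < fst v" using r_less uS by blast
          with 2 q(1) show ?thesis by (auto simp: S_def)
        qed (use that in auto)
      qed
    qed (use fin in auto)
    finally show ?thesis .
  qed
  have "spaced V k (c(u := i))"
    unfolding spaced_def
  proof (intro ballI impI, elim conjE)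
    fix p q assume pq: "p \<in> V" "q \<in> V" "fst p < fst q" "(c(u := i)) p = (c(u := i)) q"
      and nz: "(c(u := i)) p \<noteq> 0"
    consider "p = u" | "q = u" | "p \<noteq> u" "q \<noteq> u" by blast
    then show "k \<le> card {v \<in> V. fst p < fst v \<and> fst v \<le> fst q}"
    proof cases
      case 1
      then show ?thesis using right[of q] pq by (cases "q = u") auto
    next
      case 2
      then show ?thesis using left[of p] pq by (cases "p = u") auto
    next
      case 3
      then show ?thesis using spaced pq nz unfolding spaced_def by auto
    qed
  qed
  then show ?thesis using that[of u] uV u(2) by blast
qed

text \<open>
  Repairing deficient blocks one at a time terminates, because each repair uses up an uncoloured point.
  Coloured points are never changed, and this keeps earlier achievements intact.
\<close>

lemma spaced_extend:
  assumes fin: "finite V" and inj: "inj_on fst V"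
    and "\<forall>v\<in>V. c v \<le> k" "spaced V k c"
  obtains d where "\<forall>v\<in>V. d v \<le> k" "spaced V k d" "\<forall>v. c v \<noteq> 0 \<longrightarrow> d v = c v"
    "\<forall>a b. card {v \<in> V. a \<le> fst v \<and> fst v \<le> b} = 3 * k - 2 \<longrightarrow>
       {1..k} \<subseteq> d ` {v \<in> V. a \<le> fst v \<and> fst v \<le> b}"
proof -
  have "\<exists>d. (\<forall>v\<in>V. d v \<le> k) \<and> spaced V k d \<and> (\<forall>v. c v \<noteq> 0 \<longrightarrow> d v = c v) \<and>
    (\<forall>a b. card {v \<in> V. a \<le> fst v \<and> fst v \<le> b} = 3 * k - 2 \<longrightarrow>
       {1..k} \<subseteq> d ` {v \<in> V. a \<le> fst v \<and> fst v \<le> b})"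
    using assms(3,4)
  proof (induction "card {v \<in> V. c v = 0}" arbitrary: c rule: less_induct)
    case less
    show ?case
    proof (cases "\<forall>a b. card {v \<in> V. a \<le> fst v \<and> fst v \<le> b} = 3 * k - 2 \<longrightarrow>
       {1..k} \<subseteq> c ` {v \<in> V. a \<le> fst v \<and> fst v \<le> b}")
      case True
      with less.prems show ?thesis by blast
    next
      case False
      then obtain a b i where i: "i \<in> {1..k}"
        and card_S: "card {v \<in> V. a \<le> fst v \<and> fst v \<le> b} = 3 * k - 2"
        and no_i: "i \<notin> c ` {v \<in> V. a \<le> fst v \<and> fst v \<le> b}"
        by blast
      have "\<forall>v\<in>V. a \<le> fst v \<and> fst v \<le> b \<longrightarrow> c v \<noteq> i" using no_i by blast
      then obtain u where u: "u \<in> V" "c u = 0" "spaced V k (c(u := i))"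
        using spaced_recolor[OF fin inj less.prems i card_S] by blast
      have "{v \<in> V. (c(u := i)) v = 0} \<subset> {v \<in> V. c v = 0}"
        using u i by auto
      then have dec: "card {v \<in> V. (c(u := i)) v = 0} < card {v \<in> V. c v = 0}"
        using fin by (intro psubset_card_mono) auto
      have le: "\<forall>v\<in>V. (c(u := i)) v \<le> k" using less.prems(1) i by simp
      obtain d where d: "\<forall>v\<in>V. d v \<le> k" "spaced V k d"
          "\<forall>v. (c(u := i)) v \<noteq> 0 \<longrightarrow> d v = (c(u := i)) v"
          "\<forall>a b. card {v \<in> V. a \<le> fst v \<and> fst v \<le> b} = 3 * k - 2 \<longrightarrow>
             {1..k} \<subseteq> d ` {v \<in> V. a \<le> fst v \<and> fst v \<le> b}"
        using less.hyps[OF dec le u(3)] by blast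
      have "\<forall>v. c v \<noteq> 0 \<longrightarrow> d v = c v"
        using d(3) u(2) by (metis fun_upd_other)
      with d show ?thesis by blast
    qed
  qed
  then show ?thesis using that by blast
qed

text \<open>
  Induction in the order of insertion, from bottom to top. A rectangle containing the new topmost
  point \<open>p\<close> reaches above all other points, so only its \<open>x\<close>-range matters and
  \<open>spaced_extend\<close> takes care of it. A rectangle avoiding \<open>p\<close> is already polychromatic by induction,
  and stays so under extension of the colouring.
\<close>

lemma partial_coloring_bottomless:
  assumes "finite V" "general_position V"
  shows "\<exists>c. (\<forall>v\<in>V. c v \<le> k) \<and> spaced V k c \<and>
    (\<forall>R\<in>bottomless_rectangles. card (V \<inter> R) = 3 * k - 2 \<longrightarrow> {1..k} \<subseteq> c ` (V \<inter> R))"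
  using assms
proof (induction V rule: finite_ranking_induct[where f = snd])
  case empty
  then show ?case by (intro exI[of _ "\<lambda>_. 0"]) (auto simp: spaced_def)
next
  case (insert p V)
  show ?case
  proof (cases "p \<in> V")
    case True
    with insert show ?thesis by (simp add: insert_absorb)
  next
    case False
    obtain c where c: "\<forall>v\<in>V. c v \<le> k" "spaced V k c"
      "\<forall>R\<in>bottomless_rectangles. card (V \<inter> R) = 3 * k - 2 \<longrightarrow> {1..k} \<subseteq> c ` (V \<inter> R)"
      using insert.IH general_position_subset[OF insert.prems, of V] by blast
    let ?V = "insert p V"
    have "spaced ?V k (c(p := 0))"
      unfolding spaced_def
    proof (intro ballI impI, elim conjE)
      fix u v assume uv: "u \<in> ?V" "v \<in> ?V" "fst u < fst v"
        "(c(p := 0)) u = (c(p := 0)) v" "(c(p := 0)) u \<noteq> 0"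
      then have "u \<noteq> p" "v \<noteq> p" by (auto split: if_splits)
      with uv have "k \<le> card {w \<in> V. fst u < fst w \<and> fst w \<le> fst v}"
        using c(2) unfolding spaced_def by auto
      also have "\<dots> \<le> card {w \<in> ?V. fst u < fst w \<and> fst w \<le> fst v}"
        using insert.hyps(1) by (intro card_mono) auto
      finally show "k \<le> card {w \<in> ?V. fst u < fst w \<and> fst w \<le> fst v}" .
    qed
    moreover have "\<forall>v\<in>?V. (c(p := 0)) v \<le> k" using c(1) by simp
    ultimately obtain d where d: "\<forall>v\<in>?V. d v \<le> k" "spaced ?V k d"
      "\<forall>v. (c(p := 0)) v \<noteq> 0 \<longrightarrow> d v = (c(p := 0)) v"
      "\<forall>a b. card {v \<in> ?V. a \<le> fst v \<and> fst v \<le> b} = 3 * k - 2 \<longrightarrow>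
         {1..k} \<subseteq> d ` {v \<in> ?V. a \<le> fst v \<and> fst v \<le> b}"
      using spaced_extend[of ?V "c(p := 0)" k] insert.hyps(1)
        inj_on_fst_general_position[OF insert.prems] by blast
    have "{1..k} \<subseteq> d ` (?V \<inter> R)"
      if R: "R \<in> bottomless_rectangles" and card: "card (?V \<inter> R) = 3 * k - 2" for R
    proof (cases "p \<in> R")
      case True
      obtain a b t where abt: "R = {a..b} \<times> {..t}"
        using R unfolding bottomless_rectangles_def by blast
      have "?V \<inter> R = {v \<in> ?V. a \<le> fst v \<and> fst v \<le> b}"
        using True insert.hyps(2) unfolding abt by (force simp: mem_Times_iff)
      with d(4) card show ?thesis by simp
    next
      case False
      then have eq: "?V \<inter> R = V \<inter> R" by blast
      show ?thesis
      proof
        fix i assume i: "i \<in> {1..k}"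
        then obtain v where v: "v \<in> V \<inter> R" "c v = i"
          using c(3) R card eq by (metis (no_types, lifting) imageE subsetD)
        then have "d v = i"
          using d(3) i \<open>p \<notin> V\<close> by (metis IntD1 atLeastAtMost_iff fun_upd_other not_one_le_zero)
        then show "i \<in> d ` (?V \<inter> R)"
          unfolding eq using v(1) by (intro image_eqI[of _ _ v]) simp_all
      qed
    qed
    with d show ?thesis by blast
  qed
qed

lemma threshold_bottomless:
  assumes "1 \<le> k"
  shows "threshold bottomless_rectangles k (3 * k - 2)"
  unfolding threshold_def
proof (intro conjI allI impI, goal_cases)
  case 1
  show ?case using assms by simp
next
  case (2 V)
  then obtain c where c: "\<forall>v\<in>V. c v \<le> k"
    "\<forall>R\<in>bottomless_rectangles. card (V \<inter> R) = 3 * k - 2 \<longrightarrow> {1..k} \<subseteq> c ` (V \<inter> R)"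
    using partial_coloring_bottomless[of V k] by blast
  let ?d = "\<lambda>v. if c v = 0 then 1 else c v"
  have "{1..k} \<subseteq> ?d ` (V \<inter> R)"
    if "R \<in> bottomless_rectangles" "card (V \<inter> R) = 3 * k - 2" for R
  proof
    fix i assume "i \<in> {1..k}"
    moreover from this have "i \<in> c ` (V \<inter> R)"
      using c(2) that by blast
    ultimately show "i \<in> ?d ` (V \<inter> R)"
      by (auto simp: image_iff)
  qed
  moreover have "?d \<in> V \<rightarrow> {1..k}" using c(1) assms by auto
  ultimately show ?case by blast
qed

section \<open>Adding topless rectangles\<close>

text \<open>Reflection in the \<open>x\<close>-axis exchanges the two kinds of rectangles.\<close>

lemma threshold_topless:
  assumes "threshold bottomless_rectangles k m"
  shows "threshold topless_rectangles k m"
  unfolding threshold_def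
proof (intro conjI allI impI, goal_cases)
  case 1
  show ?case using assms by (simp add: threshold_def)
next
  case (2 V)
  let ?f = "\<lambda>p::point. (fst p, - snd p)"
  have inj: "inj_on ?f A" for A by (auto simp: inj_on_def prod_eq_iff)
  have "general_position (?f ` V)"
    using 2 unfolding general_position_def by auto
  then obtain c where c: "c \<in> ?f ` V \<rightarrow> {1..k}"
    "\<forall>R\<in>bottomless_rectangles. card (?f ` V \<inter> R) = m \<longrightarrow> {1..k} \<subseteq> c ` (?f ` V \<inter> R)"
    using assms 2 unfolding threshold_def by (meson finite_imageI)
  have "{1..k} \<subseteq> (c \<circ> ?f) ` (V \<inter> R)" if R: "R \<in> topless_rectangles" and card: "card (V \<inter> R) = m" for R
  proof -
    obtain a b t where abt: "R = {a..b} \<times> {t..}"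
      using R unfolding topless_rectangles_def by blast
    have eq: "?f ` V \<inter> {a..b} \<times> {..-t} = ?f ` (V \<inter> R)"
      unfolding abt by (auto simp: image_iff)
    moreover have "{a..b} \<times> {..-t} \<in> bottomless_rectangles"
      unfolding bottomless_rectangles_def by blast
    moreover have "card (?f ` (V \<inter> R)) = m"
      using card card_image[OF inj] by simp
    ultimately have "{1..k} \<subseteq> c ` (?f ` (V \<inter> R))"
      using c(2)[rule_format, of "{a..b} \<times> {..-t}"] by simp
    then show ?thesis by (simp add: image_comp)
  qed
  moreover have "c \<circ> ?f \<in> V \<rightarrow> {1..k}"
    using c(1) by (simp add: Pi_iff)
  ultimately show ?case by blast
qed

text \<open>
  In \<open>x\<close>-order the points are paired as first and second, third and fourth, and so on. If their number
  is odd, the rightmost point has no partner.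
\<close>

definition paired :: "point set \<Rightarrow> point \<Rightarrow> point \<Rightarrow> bool" where
  "paired V v w \<longleftrightarrow> v \<noteq> w \<and> rank fst V v div 2 = rank fst V w div 2"

lemma card_le_one_if_no_less:
  fixes f :: "'a \<Rightarrow> 'b::linorder"
  assumes "inj_on f A" "\<And>x y. x \<in> A \<Longrightarrow> y \<in> A \<Longrightarrow> f x < f y \<Longrightarrow> False"
  shows "card A \<le> 1"
proof -
  have "x = y" if "x \<in> A" "y \<in> A" for x y
    using assms that by (metis inj_onD linorder_less_linear)
  then show ?thesis
    by (cases "finite A") (auto simp: card_le_Suc0_iff_eq)
qed

text \<open>
  The height \<open>h\<close> is \<open>snd\<close> for bottomless and its negative for topless rectangles. Each unchosen point
  in \<open>R\<close> whose partner is also in \<open>R\<close> is charged to that partner. The partner of an exceptional point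
  is chosen, hence low enough for \<open>R\<close>, so it can only escape horizontally. A point of odd rank has its
  partner as left neighbour, so it is exceptional only if it is the leftmost point in \<open>R\<close>; a point of
  even rank likewise only if it is the rightmost. This covers a point without a partner, which has
  even rank and is the rightmost point of \<open>V\<close>. So there are at most two exceptional points.
\<close>

lemma card_le_two_card_chosen:
  fixes h :: "point \<Rightarrow> real"
  assumes fin: "finite V" and inj: "inj_on fst V"
    and chosen: "\<And>v w. v \<in> V \<Longrightarrow> w \<in> V \<Longrightarrow> paired V v w \<Longrightarrow> v \<notin> A \<Longrightarrow> w \<in> A \<and> h w < h v"
    and R: "R = {p. a \<le> fst p \<and> fst p \<le> b \<and> h p \<le> t}"
  shows "card (V \<inter> R) \<le> 2 * card (A \<inter> V \<inter> R) + 2"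
proof -
  let ?r = "rank fst V"
  \<comment> \<open>\<open>B\<close> collects the unchosen points of \<open>R\<close>, and \<open>E\<close> those of them whose partner is missing or
    lies outside \<open>R\<close>.\<close>
  define B where "B = V \<inter> R - A"
  define E where "E = {v \<in> B. \<not> (\<exists>w \<in> V \<inter> R. paired V v w)}"
  have injE: "inj_on fst {v \<in> E. P v}" for P
    using inj by (rule inj_on_subset) (auto simp: E_def B_def)
  \<comment> \<open>the partner of an exceptional point cannot lie horizontally between two points of \<open>R\<close>\<close>
  have escape: False
    if "u \<in> E" "v \<in> E" "x \<in> E" "w \<in> V" "paired V u w" "fst v \<le> fst w" "fst w \<le> fst x" for u v w x
  proof -
    have "h w < h u" using chosen[of u w] that by (auto simp: E_def B_def)
    then have "w \<in> R" using that by (auto simp: E_def B_def R)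
    with that show False by (auto simp: E_def)
  qed
  have "card {v \<in> E. even (?r v)} \<le> 1"
  proof (rule card_le_one_if_no_less[OF injE])
    fix u v assume uv: "u \<in> {v \<in> E. even (?r v)}" "v \<in> {v \<in> E. even (?r v)}" "fst u < fst v"
    then have V: "u \<in> V" "v \<in> V" by (auto simp: E_def B_def)
    have lt: "?r u < ?r v" using rank_less_iff[OF fin V, of fst] uv by simp
    have "?r v < card V"
      using bij_betwE[OF bij_betw_rank[OF fin inj]] V(2) by simp
    then have "Suc (?r u) < card V" using lt by simp
    then obtain w where w: "w \<in> V" "?r w = Suc (?r u)"
      using ex_of_rank[OF fin inj] by blast
    have "paired V u w"
      using uv w unfolding paired_def by auto
    moreover have "fst u \<le> fst w" "fst w \<le> fst v"
      using rank_le_iff[OF fin V(1) w(1), of fst] rank_le_iff[OF fin w(1) V(2), of fst] w lt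
      by simp_all
    ultimately show False using escape[of u u v w] uv w by auto
  qed
  moreover have "card {v \<in> E. odd (?r v)} \<le> 1"
  proof (rule card_le_one_if_no_less[OF injE])
    fix u v assume uv: "u \<in> {v \<in> E. odd (?r v)}" "v \<in> {v \<in> E. odd (?r v)}" "fst u < fst v"
    then have V: "u \<in> V" "v \<in> V" by (auto simp: E_def B_def)
    have lt: "?r u < ?r v" using rank_less_iff[OF fin V, of fst] uv by simp
    have "?r v < card V"
      using bij_betwE[OF bij_betw_rank[OF fin inj]] V(2) by simp
    then have "?r v - 1 < card V" by simp
    then obtain w where w: "w \<in> V" "?r w = ?r v - 1"
      using ex_of_rank[OF fin inj] by blast
    have "paired V v w"
      using uv w lt unfolding paired_def by (auto elim!: oddE)
    moreover have "fst u \<le> fst w" "fst w \<le> fst v"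
      using rank_le_iff[OF fin V(1) w(1), of fst] rank_le_iff[OF fin w(1) V(2), of fst] w lt
      by linarith+
    ultimately show False using escape[of v u v w] uv w by auto
  qed
  moreover have "E = {v \<in> E. even (?r v)} \<union> {v \<in> E. odd (?r v)}" by blast
  ultimately have cardE: "card E \<le> 2"
    using card_Un_le[of "{v \<in> E. even (?r v)}" "{v \<in> E. odd (?r v)}"] by simp
  have "\<exists>g. \<forall>v \<in> B - E. g v \<in> V \<inter> R \<and> paired V v (g v)"
    by (rule bchoice) (auto simp: E_def)
  then obtain g where g: "\<And>v. v \<in> B - E \<Longrightarrow> g v \<in> V \<inter> R \<and> paired V v (g v)"
    by blast
  have "card (B - E) \<le> card (A \<inter> V \<inter> R)"
  proof (rule card_inj_on_le)
    show "inj_on g (B - E)"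
    proof (rule inj_onI, rule ccontr)
      fix u v assume uv: "u \<in> B - E" "v \<in> B - E" "g u = g v" "u \<noteq> v"
      then have "paired V u v"
        using g[of u] g[of v] by (auto simp: paired_def)
      then show False using chosen[of u v] uv by (auto simp: B_def)
    qed
    show "g ` (B - E) \<subseteq> A \<inter> V \<inter> R"
      using g chosen by (fastforce simp: B_def)
    show "finite (A \<inter> V \<inter> R)" using fin by simp
  qed
  moreover have "card (V \<inter> R) \<le> card (A \<inter> V \<inter> R) + (card (B - E) + card E)"
  proof -
    have "V \<inter> R = A \<inter> V \<inter> R \<union> ((B - E) \<union> E)"
      unfolding B_def E_def by blast
    then have "card (V \<inter> R) \<le> card (A \<inter> V \<inter> R) + card ((B - E) \<union> E)"
      using card_Un_le[of "A \<inter> V \<inter> R" "(B - E) \<union> E"] by simp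
    also have "\<dots> \<le> card (A \<inter> V \<inter> R) + (card (B - E) + card E)"
      using card_Un_le[of "B - E" E] by simp
    finally show ?thesis .
  qed
  ultimately show ?thesis using cardE by linarith
qed

lemma eq_if_div_2_eq:
  fixes a b c :: nat
  assumes "a \<noteq> b" "a \<noteq> c" "a div 2 = b div 2" "a div 2 = c div 2"
  shows "b = c"
proof -
  have "a mod 2 \<noteq> b mod 2" "a mod 2 \<noteq> c mod 2"
    using assms by (metis div_mult_mod_eq)+
  then have "b mod 2 = c mod 2"
    by (auto simp: mod2_eq_if split: if_splits)
  with assms show ?thesis by (metis div_mult_mod_eq)
qed

text \<open>
  Within a pair, the lower point is the chosen one for bottomless rectangles and the upper point for
  topless ones, so a single partition meets the requirement of \<open>card_le_two_card_chosen\<close> for both.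
\<close>

lemma ex_balanced_partition:
  assumes fin: "finite V" and gp: "general_position V"
  obtains A where "A \<subseteq> V"
    "\<And>R. R \<in> bottomless_rectangles \<Longrightarrow> card (V \<inter> R) \<le> 2 * card (A \<inter> R) + 2"
    "\<And>R. R \<in> topless_rectangles \<Longrightarrow> card (V \<inter> R) \<le> 2 * card ((V - A) \<inter> R) + 2"
proof -
  note inj = inj_on_fst_general_position[OF gp]
  have r_inj: "inj_on (rank fst V) V"
    using bij_betw_rank[OF fin inj] by (simp add: bij_betw_def)
  define A where "A = {v \<in> V. \<forall>w\<in>V. paired V v w \<longrightarrow> snd v < snd w}"
  have third: "w = w'" if "v \<in> V" "w \<in> V" "w' \<in> V" "paired V v w" "paired V v w'" for v w w'
  proof -
    have "rank fst V v \<noteq> rank fst V w" "rank fst V v \<noteq> rank fst V w'"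
      using that inj_on_eq_iff[OF r_inj] by (auto simp: paired_def)
    moreover have "rank fst V v div 2 = rank fst V w div 2" "rank fst V v div 2 = rank fst V w' div 2"
      using that by (auto simp: paired_def)
    ultimately have "rank fst V w = rank fst V w'"
      by (rule eq_if_div_2_eq[of "rank fst V v"])
    with that show ?thesis using inj_on_eq_iff[OF r_inj] by blast
  qed
  have sym: "paired V v w \<longleftrightarrow> paired V w v" for v w by (auto simp: paired_def)
  have neq: "snd v \<noteq> snd w" if "v \<in> V" "w \<in> V" "paired V v w" for v w
    using that gp by (auto simp: paired_def general_position_def)
  have mem: "v \<in> A \<longleftrightarrow> snd v < snd w" if "v \<in> V" "w \<in> V" "paired V v w" for v w
  proof -
    have "(\<forall>w'\<in>V. paired V v w' \<longrightarrow> snd v < snd w') \<longleftrightarrow> snd v < snd w"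
      using that third by blast
    with that(1) show ?thesis by (simp add: A_def)
  qed
  show ?thesis
  proof (rule that[of A])
    show "A \<subseteq> V" by (auto simp: A_def)
    then have AV: "A \<inter> V = A" "(V - A) \<inter> V = V - A" by auto
    show "card (V \<inter> R) \<le> 2 * card (A \<inter> R) + 2" if "R \<in> bottomless_rectangles" for R
    proof -
      obtain a b t where abt: "R = {a..b} \<times> {..t}"
        using \<open>R \<in> _\<close> unfolding bottomless_rectangles_def by blast
      have "card (V \<inter> R) \<le> 2 * card (A \<inter> V \<inter> R) + 2"
      proof (rule card_le_two_card_chosen[OF fin inj, where h = snd])
        show "R = {p. a \<le> fst p \<and> fst p \<le> b \<and> snd p \<le> t}"
          unfolding abt by auto
        show "w \<in> A \<and> snd w < snd v" if "v \<in> V" "w \<in> V" "paired V v w" "v \<notin> A" for v w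
          using mem[OF that(1-3)] mem[OF that(2,1)] neq[OF that(1-3)] sym[of v w] that by auto
      qed
      then show ?thesis using AV by simp
    qed
    show "card (V \<inter> R) \<le> 2 * card ((V - A) \<inter> R) + 2" if "R \<in> topless_rectangles" for R
    proof -
      obtain a b t where abt: "R = {a..b} \<times> {t..}"
        using \<open>R \<in> _\<close> unfolding topless_rectangles_def by blast
      have "card (V \<inter> R) \<le> 2 * card ((V - A) \<inter> V \<inter> R) + 2"
      proof (rule card_le_two_card_chosen[OF fin inj, where h = "\<lambda>p. - snd p"])
        show "R = {p. a \<le> fst p \<and> fst p \<le> b \<and> - snd p \<le> - t}"
          unfolding abt by auto
        show "w \<in> V - A \<and> - snd w < - snd v"
          if "v \<in> V" "w \<in> V" "paired V v w" "v \<notin> V - A" for v w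
          using mem[OF that(1-3)] mem[OF that(2,1)] sym[of v w] that by auto
      qed
      then show ?thesis using AV by simp
    qed
  qed
qed

text \<open>
  A threshold speaks about rectangles with exactly \<open>m\<close> points only. Lowering the top side loses the
  points one by one, so larger rectangles contain one with exactly \<open>m\<close> points.
\<close>

lemma shrink_bottomless:
  assumes "finite V" "general_position V" "1 \<le> m" "R \<in> bottomless_rectangles" "m \<le> card (V \<inter> R)"
  obtains R' where "R' \<in> bottomless_rectangles" "R' \<subseteq> R" "card (V \<inter> R') = m"
proof -
  obtain a b t where abt: "R = {a..b} \<times> {..t}"
    using assms(4) unfolding bottomless_rectangles_def by blast
  have "inj_on snd (V \<inter> R)"
    using inj_on_snd_general_position[OF assms(2)] by (rule inj_on_subset) simp
  then obtain s where s: "card {v \<in> V \<inter> R. snd v \<le> s} = m"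
    using ex_lower_part_card[of "V \<inter> R" snd m] assms(1,3,5) by blast
  have "{v \<in> V \<inter> R. snd v \<le> s} = V \<inter> {a..b} \<times> {..min s t}"
    unfolding abt by auto
  with s have "card (V \<inter> {a..b} \<times> {..min s t}) = m" by simp
  moreover have "{a..b} \<times> {..min s t} \<in> bottomless_rectangles"
    unfolding bottomless_rectangles_def by blast
  moreover have "{a..b} \<times> {..min s t} \<subseteq> R" unfolding abt by auto
  ultimately show ?thesis using that by blast
qed

lemma shrink_topless:
  assumes "finite V" "general_position V" "1 \<le> m" "R \<in> topless_rectangles" "m \<le> card (V \<inter> R)"
  obtains R' where "R' \<in> topless_rectangles" "R' \<subseteq> R" "card (V \<inter> R') = m"
proof -
  obtain a b t where abt: "R = {a..b} \<times> {t..}"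
    using assms(4) unfolding topless_rectangles_def by blast
  have "inj_on snd (V \<inter> R)"
    using inj_on_snd_general_position[OF assms(2)] by (rule inj_on_subset) simp
  then have "inj_on (\<lambda>v. - snd v) (V \<inter> R)" by (simp add: inj_on_def)
  then obtain s where s: "card {v \<in> V \<inter> R. - snd v \<le> s} = m"
    using ex_lower_part_card[of "V \<inter> R" "\<lambda>v. - snd v" m] assms(1,3,5) by blast
  have "{v \<in> V \<inter> R. - snd v \<le> s} = V \<inter> {a..b} \<times> {max (- s) t..}"
    unfolding abt by auto
  with s have "card (V \<inter> {a..b} \<times> {max (- s) t..}) = m" by simp
  moreover have "{a..b} \<times> {max (- s) t..} \<in> topless_rectangles"
    unfolding topless_rectangles_def by blast
  moreover have "{a..b} \<times> {max (- s) t..} \<subseteq> R" unfolding abt by auto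
  ultimately show ?thesis using that by blast
qed

lemma threshold_bottomless_topless:
  assumes BL: "threshold bottomless_rectangles k m"
  shows "threshold (bottomless_rectangles \<union> topless_rectangles) k (2 * m + 1)"
  unfolding threshold_def
proof (intro conjI allI impI, goal_cases)
  case 1
  show ?case by simp
next
  case (2 V)
  then have fin: "finite V" and gp: "general_position V" by auto
  have m: "1 \<le> m" using BL by (simp add: threshold_def)
  obtain A where A: "A \<subseteq> V"
    "\<And>R. R \<in> bottomless_rectangles \<Longrightarrow> card (V \<inter> R) \<le> 2 * card (A \<inter> R) + 2"
    "\<And>R. R \<in> topless_rectangles \<Longrightarrow> card (V \<inter> R) \<le> 2 * card ((V - A) \<inter> R) + 2"
    using ex_balanced_partition[OF fin gp] by blast
  have finA: "finite A" "finite (V - A)" and gpA: "general_position A" "general_position (V - A)"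
    using fin gp A(1) by (auto intro: finite_subset general_position_subset)
  obtain c where c: "c \<in> A \<rightarrow> {1..k}"
      "\<forall>R\<in>bottomless_rectangles. card (A \<inter> R) = m \<longrightarrow> {1..k} \<subseteq> c ` (A \<inter> R)"
    using BL finA(1) gpA(1) unfolding threshold_def by blast
  obtain d where d: "d \<in> V - A \<rightarrow> {1..k}"
      "\<forall>R\<in>topless_rectangles. card ((V - A) \<inter> R) = m \<longrightarrow> {1..k} \<subseteq> d ` ((V - A) \<inter> R)"
    using threshold_topless[OF BL] finA(2) gpA(2) unfolding threshold_def by blast
  let ?e = "\<lambda>v. if v \<in> A then c v else d v"
  have "{1..k} \<subseteq> ?e ` (V \<inter> R)"
    if R: "R \<in> bottomless_rectangles \<union> topless_rectangles" and card: "card (V \<inter> R) = 2 * m + 1" for R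
    using R
  proof
    assume R: "R \<in> bottomless_rectangles"
    then have "m \<le> card (A \<inter> R)" using A(2)[OF R] card by simp
    then obtain R' where R': "R' \<in> bottomless_rectangles" "R' \<subseteq> R" "card (A \<inter> R') = m"
      using shrink_bottomless[OF finA(1) gpA(1) m R] by blast
    then have "{1..k} \<subseteq> c ` (A \<inter> R')" using c(2) by blast
    also have "c ` (A \<inter> R') = ?e ` (A \<inter> R')" by (rule image_cong) auto
    also have "\<dots> \<subseteq> ?e ` (V \<inter> R)" using A(1) R'(2) by (intro image_mono) blast
    finally show ?thesis .
  next
    assume R: "R \<in> topless_rectangles"
    then have "m \<le> card ((V - A) \<inter> R)" using A(3)[OF R] card by simp
    then obtain R' where R': "R' \<in> topless_rectangles" "R' \<subseteq> R" "card ((V - A) \<inter> R') = m"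
      using shrink_topless[OF finA(2) gpA(2) m R] by blast
    then have "{1..k} \<subseteq> d ` ((V - A) \<inter> R')" using d(2) by blast
    also have "d ` ((V - A) \<inter> R') = ?e ` ((V - A) \<inter> R')" by (rule image_cong) auto
    also have "\<dots> \<subseteq> ?e ` (V \<inter> R)" using R'(2) by (intro image_mono) blast
    finally show ?thesis .
  qed
  moreover have "?e \<in> V \<rightarrow> {1..k}" using c(1) d(1) by (simp add: Pi_iff)
  ultimately show ?case by blast
qed

theorem theorem19:
  fixes k :: nat
  assumes "k \<ge> 1"
  shows "m_poly (bottomless_rectangles \<union> topless_rectangles) k
           \<le> 2 * m_poly bottomless_rectangles k + 1
       \<and> 2 * m_poly bottomless_rectangles k + 1 \<le> enat (6 * k - 3)"
proof -
  note BL = threshold_bottomless[OF assms]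
  obtain m where m: "m_poly bottomless_rectangles k = enat m" "threshold bottomless_rectangles k m"
    using m_poly_attained[OF BL] .
  have "m \<le> 3 * k - 2" using m_poly_le[OF BL] m(1) by simp
  then have "2 * m + 1 \<le> 6 * k - 3" using assms by simp
  moreover have "2 * m_poly bottomless_rectangles k + 1 = enat (2 * m + 1)"
    unfolding m(1) by (simp add: numeral_eq_enat one_enat_def)
  ultimately show ?thesis
    using m_poly_le[OF threshold_bottomless_topless[OF m(2)]] by simp
qed

end
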